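(* Let $\langle S,\leq_S\rangle$ be a directed partial order with no maximum and let $\lambda$ be an infinite cardinal. Then \[\mathfrak{d}_S^\lambda=\mathfrak{d}_S^\lambda(\leq^* )\cdot\sup\{\mathfrak{d}_S^\kappa:\kappa<\lambda\text{ a non-zero cardinal}\}.\]
   Context: For a non-zero cardinal $\mu$, $\mathfrak{d}_S^\mu$ is the least size of a family $D\subseteq S^\mu$ such that every $X\in S^\mu$ is pointwise dominated by some $Y\in D$, i.e. $X(\alpha)\leq_S Y(\alpha)$ for all $\alpha<\mu$. For infinite $\lambda$, $\mathfrak{d}_S^\lambda(\leq^* )$ is the least size of $D\subseteq S^\lambda$ such that for every $X\in S^\lambda$ there are $Y\in D$ and $\alpha<\lambda$ with $X(\beta)\leq_S Y(\beta)$ for all $\beta\in[\alpha,\lambda)$. *)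

theory Defs
  imports Main
begin

unbundle cardinal_syntax

text \<open>
  Cardinals are the cardinal-order relations of Main: a cardinal \<open>\<mu>\<close> is a relation with
  \<open>Card_order \<mu>\<close>, its underlying set of ordinals is \<open>Field \<mu>\<close>, and equality and comparison of
  cardinals are \<open>=o\<close>, \<open>\<le>o\<close>, \<open><o\<close>. The power \<open>S\<^sup>\<mu>\<close> is \<open>Func (Field \<mu>) S\<close>, whose elements take the
  value \<open>undefined\<close> outside \<open>Field \<mu>\<close>. A partial order on \<open>S\<close> is a relation \<open>le\<close> with
  \<open>partial_order_on S le\<close>.
\<close>

definition directed_on :: "'a set \<Rightarrow> 'a rel \<Rightarrow> bool" where
  "directed_on S le \<longleftrightarrow> (\<forall>x\<in>S. \<forall>y\<in>S. \<exists>z\<in>S. (x, z) \<in> le \<and> (y, z) \<in> le)"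

definition has_maximum_on :: "'a set \<Rightarrow> 'a rel \<Rightarrow> bool" where
  "has_maximum_on S le \<longleftrightarrow> (\<exists>m\<in>S. \<forall>x\<in>S. (x, m) \<in> le)"

definition least_cardinal :: "'c rel set \<Rightarrow> 'c rel" where
  "least_cardinal R = (SOME r. r \<in> R \<and> (\<forall>s\<in>R. r \<le>o s))"

lemma least_cardinal_spec:
  assumes "R \<noteq> {}" and "\<forall>r\<in>R. Card_order r"
  shows "least_cardinal R \<in> R \<and> (\<forall>s\<in>R. least_cardinal R \<le>o s)"
  using someI_ex[of "\<lambda>r. r \<in> R \<and> (\<forall>s\<in>R. r \<le>o s)"] exists_minim_Card_order[OF assms]
  unfolding least_cardinal_def by blast

text \<open>
  The supremum is taken among the cardinals living on the same type as the members of the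
  family; \<open>card_Sup_upper\<close> and \<open>card_Sup_least\<close> show that it exists there, and that it is least
  also among upper bounds living on other types.
\<close>

definition card_Sup :: "'c rel set \<Rightarrow> 'c rel" where
  "card_Sup R = least_cardinal {s. Card_order s \<and> (\<forall>r\<in>R. r \<le>o s)}"

lemma Card_order_ordLeq_UNIV:
  fixes r :: "'c rel"
  assumes "Card_order r"
  shows "r \<le>o |UNIV :: 'c set|"
  using ordIso_ordLeq_trans[OF ordIso_symmetric[OF card_of_Field_ordIso[OF assms]] card_of_mono1[OF subset_UNIV]] .

lemma card_Sup_spec:
  fixes R :: "'c rel set"
  assumes "\<forall>r\<in>R. Card_order r"
  shows "Card_order (card_Sup R) \<and> (\<forall>r\<in>R. r \<le>o card_Sup R) \<and>
    (\<forall>s :: 'c rel. Card_order s \<and> (\<forall>r\<in>R. r \<le>o s) \<longrightarrow> card_Sup R \<le>o s)"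
proof -
  let ?B = "{s :: 'c rel. Card_order s \<and> (\<forall>r\<in>R. r \<le>o s)}"
  have "|UNIV :: 'c set| \<in> ?B"
    using assms Card_order_ordLeq_UNIV card_of_Card_order by blast
  then have "?B \<noteq> {}" by blast
  moreover have "\<forall>s\<in>?B. Card_order s" by blast
  ultimately have "card_Sup R \<in> ?B \<and> (\<forall>s\<in>?B. card_Sup R \<le>o s)"
    unfolding card_Sup_def by (rule least_cardinal_spec)
  then show ?thesis by simp
qed

lemma card_Sup_upper:
  assumes "\<forall>r\<in>R. Card_order r" and "r \<in> R"
  shows "r \<le>o card_Sup R"
  using card_Sup_spec[OF assms(1)] assms(2) by blast

lemma card_Sup_least:
  fixes R :: "'c rel set" and s :: "'d rel"
  assumes R: "\<forall>r\<in>R. Card_order r" and s: "Card_order s" and ub: "\<forall>r\<in>R. r \<le>o s"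
  shows "card_Sup R \<le>o s"
proof (cases "|UNIV :: 'c set| \<le>o s")
  case True
  have "card_Sup R \<le>o |UNIV :: 'c set|"
    using card_Sup_spec[OF R] Card_order_ordLeq_UNIV by blast
  then show ?thesis using True by (rule ordLeq_transitive)
next
  case False
  have s_iso: "|Field s| =o s" using s by (rule card_of_Field_ordIso)
  have "s \<le>o |UNIV :: 'c set|"
    using False ordLeq_total[OF card_of_Well_order card_order_on_well_order_on[OF s]] by blast
  then have "|Field s| \<le>o |UNIV :: 'c set|" using ordIso_ordLeq_trans[OF s_iso] by blast
  then obtain B :: "'c set" where B: "|Field s| =o |B|"
    using iffD1[OF internalize_card_of_ordLeq2] by metis
  have sB: "s =o |B|" by (rule ordIso_transitive[OF ordIso_symmetric[OF s_iso] B])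
  then have "\<forall>r\<in>R. r \<le>o |B|" using ub ordLeq_ordIso_trans[OF _ sB] by blast
  then have "card_Sup R \<le>o |B|" using card_Sup_spec[OF R] card_of_Card_order by blast
  then show ?thesis using ordIso_symmetric[OF sB] by (rule ordLeq_ordIso_trans)
qed

definition dominating :: "'a set \<Rightarrow> 'a rel \<Rightarrow> 'b rel \<Rightarrow> ('b \<Rightarrow> 'a) set \<Rightarrow> bool" where
  "dominating S le \<mu> D \<longleftrightarrow> D \<subseteq> Func (Field \<mu>) S \<and>
     (\<forall>X \<in> Func (Field \<mu>) S. \<exists>Y\<in>D. \<forall>\<alpha>\<in>Field \<mu>. (X \<alpha>, Y \<alpha>) \<in> le)"

text \<open>In a well-order \<open>\<mu>\<close>, the pairs \<open>(\<alpha>, \<beta>) \<in> \<mu>\<close> are exactly those with \<open>\<beta> \<in> [\<alpha>, \<mu>)\<close>.\<close>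

definition eventually_dominating :: "'a set \<Rightarrow> 'a rel \<Rightarrow> 'b rel \<Rightarrow> ('b \<Rightarrow> 'a) set \<Rightarrow> bool" where
  "eventually_dominating S le \<mu> D \<longleftrightarrow> D \<subseteq> Func (Field \<mu>) S \<and>
     (\<forall>X \<in> Func (Field \<mu>) S. \<exists>Y\<in>D. \<exists>\<alpha>\<in>Field \<mu>. \<forall>\<beta>. (\<alpha>, \<beta>) \<in> \<mu> \<longrightarrow> (X \<beta>, Y \<beta>) \<in> le)"

text \<open>The cardinals \<open>d\<^sub>S\<^sup>\<mu>\<close> and \<open>d\<^sub>S\<^sup>\<mu>(\<le>\<^sup>*)\<close>.\<close>

definition dom_num :: "'a set \<Rightarrow> 'a rel \<Rightarrow> 'b rel \<Rightarrow> ('b \<Rightarrow> 'a) rel" where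
  "dom_num S le \<mu> = least_cardinal {|D| | D. dominating S le \<mu> D}"

definition ev_dom_num :: "'a set \<Rightarrow> 'a rel \<Rightarrow> 'b rel \<Rightarrow> ('b \<Rightarrow> 'a) rel" where
  "ev_dom_num S le \<mu> = least_cardinal {|D| | D. eventually_dominating S le \<mu> D}"

lemma dom_num_spec:
  assumes "partial_order_on S le"
  shows "\<exists>D. dominating S le \<mu> D \<and> dom_num S le \<mu> = |D| \<and>
    (\<forall>D'. dominating S le \<mu> D' \<longrightarrow> dom_num S le \<mu> \<le>o |D'| )"
proof -
  have "dominating S le \<mu> (Func (Field \<mu>) S)"
    using assms unfolding dominating_def partial_order_on_def preorder_on_def refl_on_def Func_def
    by blast
  then have "{|D| | D. dominating S le \<mu> D} \<noteq> {}" by blast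
  moreover have "\<forall>r\<in>{|D| | D. dominating S le \<mu> D}. Card_order r" using card_of_Card_order by blast
  ultimately have "dom_num S le \<mu> \<in> {|D| | D. dominating S le \<mu> D} \<and>
    (\<forall>s\<in>{|D| | D. dominating S le \<mu> D}. dom_num S le \<mu> \<le>o s)"
    unfolding dom_num_def by (rule least_cardinal_spec)
  then show ?thesis by blast
qed

lemma ev_dom_num_spec:
  assumes "partial_order_on S le" and "Field \<mu> \<noteq> {}"
  shows "\<exists>D. eventually_dominating S le \<mu> D \<and> ev_dom_num S le \<mu> = |D| \<and>
    (\<forall>D'. eventually_dominating S le \<mu> D' \<longrightarrow> ev_dom_num S le \<mu> \<le>o |D'| )"
proof -
  obtain \<alpha> where \<alpha>: "\<alpha> \<in> Field \<mu>" using assms(2) by blast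
  have "(X \<beta>, X \<beta>) \<in> le" if X: "X \<in> Func (Field \<mu>) S" and \<beta>: "(\<alpha>, \<beta>) \<in> \<mu>" for X \<beta>
  proof -
    have "X \<beta> \<in> S" using X FieldI2[OF \<beta>] by (simp add: Func_def)
    then show ?thesis
      using assms(1) by (simp add: partial_order_on_def preorder_on_def refl_on_def)
  qed
  then have "eventually_dominating S le \<mu> (Func (Field \<mu>) S)"
    using \<alpha> unfolding eventually_dominating_def by blast
  then have "{|D| | D. eventually_dominating S le \<mu> D} \<noteq> {}" by blast
  moreover have "\<forall>r\<in>{|D| | D. eventually_dominating S le \<mu> D}. Card_order r"
    using card_of_Card_order by blast
  ultimately have "ev_dom_num S le \<mu> \<in> {|D| | D. eventually_dominating S le \<mu> D} \<and>
    (\<forall>s\<in>{|D| | D. eventually_dominating S le \<mu> D}. ev_dom_num S le \<mu> \<le>o s)"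
    unfolding ev_dom_num_def by (rule least_cardinal_spec)
  then show ?thesis by blast
qed

end

theory Submission
  imports Defs
begin

text \<open>
  The cardinal \<open>\<lambda>\<close> does not appear on the right-hand side because diagonalisation gives
  \<open>\<kappa> < d\<^sub>S\<^sup>\<kappa>\<close> for every \<open>\<kappa>\<close>, so that \<open>\<lambda>\<close> is at most the supremum of the \<open>d\<^sub>S\<^sup>\<kappa>\<close> with
  \<open>\<kappa> < \<lambda>\<close>. Hence the functions which agree with a member of a dominating family on an initial
  segment of \<open>\<lambda>\<close>, and with a member of an eventually dominating family above it, are few enough,
  and they form a dominating family.
\<close>

lemma dominating_nonempty:
  assumes "dominating S le \<mu> D" and "S \<noteq> {}"
  shows "D \<noteq> {}"
proof -
  have "Func (Field \<mu>) S \<noteq> {}" using assms(2) by (simp add: Func_is_emp)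
  then show ?thesis using assms(1) unfolding dominating_def by blast
qed

text \<open>The supremum ranges over non-zero exponents only; this admits the closed initial
  segments of \<open>r\<close> among them.\<close>

lemma Cnotzero_under:
  assumes "Cinfinite r" and "a \<in> Field r"
  shows "Cnotzero |under r a|"
proof -
  have "Refl r" using card_order_on_well_order_on[OF conjunct2[OF assms(1)]]
    by (simp add: order_on_defs)
  then have "under r a \<noteq> {}" using assms(2) by (auto simp: under_def refl_on_def)
  then show ?thesis by (simp add: card_of_ordIso_czero_iff_empty card_of_Card_order)
qed

lemma Card_order_dom_num:
  assumes "partial_order_on S le"
  shows "Card_order (dom_num S le \<mu>)"
  using dom_num_spec[OF assms, of \<mu>] card_of_Card_order by metis

text \<open>Diagonalisation: a dominating family of size at most \<kappa> could be enumerated by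
  \<open>Field \<kappa>\<close>, and a function that escapes its \<open>i\<close>-th member at
  \<open>i\<close> would be dominated by none of them.\<close>

lemma less_dom_num:
  assumes po: "partial_order_on S le" and nomax: "\<not> has_maximum_on S le"
    and ne: "S \<noteq> {}" and \<kappa>: "Card_order \<kappa>"
  shows "\<kappa> <o dom_num S le \<kappa>"
proof -
  obtain D where D: "dominating S le \<kappa> D" and eq: "dom_num S le \<kappa> = |D|"
    using dom_num_spec[OF po, of \<kappa>] by blast
  have "\<not> |D| \<le>o \<kappa>"
  proof
    assume "|D| \<le>o \<kappa>"
    then have "|D| \<le>o |Field \<kappa>|"
      using ordIso_symmetric[OF card_of_Field_ordIso[OF \<kappa>]] by (rule ordLeq_ordIso_trans)
    \<comment> \<open>\<open>D\<close> is non-empty because \<open>S\<close> is, so the size bound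
      yields a surjection onto \<open>D\<close>.\<close>
    then have "\<exists>g. g ` Field \<kappa> = D"
      by (rule iffD2[OF card_of_ordLeq2[OF dominating_nonempty[OF D ne]]])
    then obtain g where g: "g ` Field \<kappa> = D" ..
    have "\<forall>y\<in>S. \<exists>x. x \<in> S \<and> (x, y) \<notin> le"
      using nomax unfolding has_maximum_on_def by blast
    then obtain h where h: "\<forall>y\<in>S. h y \<in> S \<and> (h y, y) \<notin> le"
      using bchoice[of S "\<lambda>y x. x \<in> S \<and> (x, y) \<notin> le"] by blast
    \<comment> \<open>Since \<open>le\<close> need not be total, \<open>h y\<close> is merely some
      element not below \<open>y\<close>; that is enough to defeat \<open>g i\<close> at
      \<open>i\<close>.\<close>
    define X where "X = (\<lambda>i. if i \<in> Field \<kappa> then h (g i i) else undefined)"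
    have gS: "g i i \<in> S" if "i \<in> Field \<kappa>" for i
    proof -
      have "g i \<in> Func (Field \<kappa>) S" using D g that unfolding dominating_def by blast
      then show ?thesis using that by (simp add: Func_def)
    qed
    have "X \<in> Func (Field \<kappa>) S" using gS h by (simp add: X_def Func_def)
    then obtain Y where "Y \<in> D" and Y: "\<forall>\<alpha>\<in>Field \<kappa>. (X \<alpha>, Y \<alpha>) \<in> le"
      using D unfolding dominating_def by blast
    then obtain i where "i \<in> Field \<kappa>" "Y = g i" using g by blast
    moreover from this have "(h (g i i), g i i) \<in> le" using Y by (auto simp: X_def)
    ultimately show False using gS h by blast
  qed
  then show ?thesis
    using ordLess_or_ordLeq[OF card_order_on_well_order_on[OF \<kappa>] card_of_Well_order, of D] eq by simp
qed

text \<open>An injection \<open>f\<close> of \<open>Field \<kappa>\<close> into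
  \<open>Field \<mu>\<close> pulls a family dominating on \<mu> back to one dominating on \<kappa>,
  and pulling back cannot increase its size.\<close>

lemma dom_num_mono:
  fixes \<kappa> :: "'b rel" and \<mu> :: "'c rel"
  assumes po: "partial_order_on S le" and ne: "S \<noteq> {}"
    and le: "\<kappa> \<le>o \<mu>"
  shows "dom_num S le \<kappa> \<le>o dom_num S le \<mu>"
proof -
  obtain D where D: "dominating S le \<mu> D" and eq: "dom_num S le \<mu> = |D|"
    using dom_num_spec[OF po, of \<mu>] by blast
  obtain f where f: "inj_on f (Field \<kappa>)" "f ` Field \<kappa> \<subseteq> Field \<mu>"
    using card_of_mono2[OF le] card_of_ordLeq[of "Field \<kappa>" "Field \<mu>"] by blast
  obtain s where s: "s \<in> S" using ne by blast
  define P where "P = (\<lambda>Y b. if b \<in> Field \<kappa> then Y (f b) else undefined :: 'a)"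
  have "dominating S le \<kappa> (P ` D)"
    unfolding dominating_def
  proof (intro conjI ballI)
    show "P ` D \<subseteq> Func (Field \<kappa>) S"
      using D f(2) by (fastforce simp: dominating_def Func_def P_def)
  next
    fix X assume X: "X \<in> Func (Field \<kappa>) S"
    \<comment> \<open>\<open>X\<close> is carried along \<open>f\<close>; off the image of
      \<open>f\<close> the arbitrary value \<open>s\<close> keeps the extension inside
      \<open>S\<close>.\<close>
    define X' where "X' = (\<lambda>c. if c \<in> Field \<mu>
      then if c \<in> f ` Field \<kappa> then X (the_inv_into (Field \<kappa>) f c) else s else undefined)"
    have X'f: "X' (f b) = X b" if "b \<in> Field \<kappa>" for b
      using that f by (auto simp: X'_def the_inv_into_f_f)
    have "X' c \<in> S" if "c \<in> Field \<mu>" for c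
    proof (cases "c \<in> f ` Field \<kappa>")
      case True
      then show ?thesis using X'f X by (auto simp: Func_def)
    next
      case False
      then show ?thesis using that s by (simp add: X'_def)
    qed
    then have "X' \<in> Func (Field \<mu>) S" by (simp add: Func_def X'_def)
    then obtain Y where Y: "Y \<in> D" "\<forall>\<alpha>\<in>Field \<mu>. (X' \<alpha>, Y \<alpha>) \<in> le"
      using D unfolding dominating_def by blast
    have "\<forall>\<alpha>\<in>Field \<kappa>. (X \<alpha>, P Y \<alpha>) \<in> le"
      using Y(2) X'f f(2) by (force simp: P_def)
    then show "\<exists>Y\<in>P ` D. \<forall>\<alpha>\<in>Field \<kappa>. (X \<alpha>, Y \<alpha>) \<in> le" using Y(1) by blast
  qed
  then have "dom_num S le \<kappa> \<le>o |P ` D|" using dom_num_spec[OF po, of \<kappa>] by blast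
  then show ?thesis using card_of_image eq ordLeq_transitive by metis
qed

lemma ev_dom_num_le_dom_num:
  assumes po: "partial_order_on S le" and ne: "Field \<mu> \<noteq> {}"
  shows "ev_dom_num S le \<mu> \<le>o dom_num S le \<mu>"
proof -
  obtain D where D: "dominating S le \<mu> D" and eq: "dom_num S le \<mu> = |D|"
    using dom_num_spec[OF po, of \<mu>] by blast
  have "eventually_dominating S le \<mu> D"
    unfolding eventually_dominating_def
  proof (intro conjI ballI)
    show "D \<subseteq> Func (Field \<mu>) S" using D by (simp add: dominating_def)
  next
    fix X assume "X \<in> Func (Field \<mu>) S"
    then obtain Y where "Y \<in> D" "\<forall>\<alpha>\<in>Field \<mu>. (X \<alpha>, Y \<alpha>) \<in> le"
      using D unfolding dominating_def by blast
    then show "\<exists>Y\<in>D. \<exists>\<alpha>\<in>Field \<mu>. \<forall>\<beta>. (\<alpha>, \<beta>) \<in> \<mu> \<longrightarrow> (X \<beta>, Y \<beta>) \<in> le"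
      using ne FieldI2 ex_in_conv by metis
  qed
  then show ?thesis using ev_dom_num_spec[OF po ne] eq by metis
qed

text \<open>An infinite cardinal has no last element, so the closed segment up to \<open>a\<close>
  lies inside the open segment below some later \<open>b\<close>, and open segments of a cardinal
  are smaller than it.\<close>

lemma card_of_under_less:
  assumes "Cinfinite r" and "a \<in> Field r"
  shows "|under r a| <o r"
proof -
  have r: "Card_order r" "\<not> finite (Field r)" using assms(1) by (auto simp: cinfinite_def)
  obtain b where b: "b \<in> Field r" "a \<noteq> b" "(a, b) \<in> r"
    using infinite_Card_order_limit[OF r(1,2) assms(2)] by blast
  have ord: "trans r" "antisym r"
    using card_order_on_well_order_on[OF r(1)]
    unfolding order_on_defs by blast+
  have "under r a \<subseteq> underS r b"
    using b ord unfolding under_def underS_def trans_def antisym_def by blast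
  then show ?thesis
    using card_of_mono1 card_of_underS[OF r(1) b(1)] ordLeq_ordLess_trans by metis
qed

text \<open>
  Since the field of \<open>|under lam \<alpha>|\<close> is the initial segment itself, the members of \<open>E \<alpha>\<close> are
  functions on that segment. The closed segment is used because it is never empty.
\<close>

lemma dominating_splice:
  assumes wo: "Well_order lam" and D: "eventually_dominating S le lam D"
    and E: "\<And>\<alpha>. \<alpha> \<in> Field lam \<Longrightarrow> dominating S le ( |under lam \<alpha>| ) (E \<alpha>)"
  shows "dominating S le lam
    ((\<lambda>(Y, \<alpha>, Z) \<beta>. if \<beta> \<in> under lam \<alpha> then Z \<beta> else Y \<beta>) ` (D \<times> (SIGMA \<alpha>:Field lam. E \<alpha>)))"
    (is "dominating _ _ _ (?splice ` ?I)")
  unfolding dominating_def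
proof (intro conjI ballI)
  have sub: "under lam \<alpha> \<subseteq> Field lam" for \<alpha> by (rule under_Field)
  show "?splice ` ?I \<subseteq> Func (Field lam) S"
  proof clarify
    fix Y \<alpha> Z assume *: "Y \<in> D" "\<alpha> \<in> Field lam" "Z \<in> E \<alpha>"
    have "Y \<in> Func (Field lam) S" using D *(1) by (auto simp: eventually_dominating_def)
    moreover have "Z \<in> Func (under lam \<alpha>) S"
      using E[OF *(2)] *(3) by (auto simp: dominating_def Field_card_of)
    ultimately show "(\<lambda>\<beta>. if \<beta> \<in> under lam \<alpha> then Z \<beta> else Y \<beta>) \<in> Func (Field lam) S"
      using sub[of \<alpha>] by (auto simp: Func_def)
  qed
next
  fix X assume X: "X \<in> Func (Field lam) S"
  obtain Y \<alpha> where Y: "Y \<in> D" "\<alpha> \<in> Field lam" "\<And>\<beta>. (\<alpha>, \<beta>) \<in> lam \<Longrightarrow> (X \<beta>, Y \<beta>) \<in> le"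
    using D X unfolding eventually_dominating_def by blast
  \<comment> \<open>Members of \<open>Func\<close> are \<open>undefined\<close> off their domain, so
    the restriction of \<open>X\<close> has to be cut off explicitly.\<close>
  let ?X = "\<lambda>\<beta>. if \<beta> \<in> under lam \<alpha> then X \<beta> else undefined"
  have "?X \<in> Func (Field |under lam \<alpha>| ) S"
    using X under_Field[of lam \<alpha>] by (auto simp: Func_def Field_card_of)
  then obtain Z where "Z \<in> E \<alpha>" "\<forall>\<beta>\<in>Field |under lam \<alpha>|. (?X \<beta>, Z \<beta>) \<in> le"
    using E[OF Y(2)] unfolding dominating_def by (elim conjE) (drule bspec, assumption, blast)
  then have Z: "Z \<in> E \<alpha>" "\<And>\<beta>. \<beta> \<in> under lam \<alpha> \<Longrightarrow> (X \<beta>, Z \<beta>) \<in> le"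
    by (auto simp: Field_card_of)
  \<comment> \<open>By totality the points outside the closed segment lie above \<alpha>, which is
    where \<open>Y\<close> dominates.\<close>
  have "(\<alpha>, \<beta>) \<in> lam" if "\<beta> \<in> Field lam" "\<beta> \<notin> under lam \<alpha>" for \<beta>
    using that Y(2) wo_rel.TOTALS[of lam] wo by (auto simp: wo_rel_def under_def)
  then have "\<forall>\<beta>\<in>Field lam. (X \<beta>, ?splice (Y, \<alpha>, Z) \<beta>) \<in> le" using Y(3) Z(2) by simp
  then show "\<exists>W\<in>?splice ` ?I. \<forall>\<beta>\<in>Field lam. (X \<beta>, W \<beta>) \<in> le"
    using Y(1,2) Z(1) by (intro bexI[of _ "?splice (Y, \<alpha>, Z)"] imageI) auto
qed

text \<open>If the supremum were below \<open>lam\<close>, it could itself serve as an exponent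
  \<kappa>, giving \<open>dom_num S le \<kappa> \<le>o \<kappa>\<close> against
  \<open>less_dom_num\<close>.\<close>

lemma le_card_Sup_dom_num:
  fixes S :: "'a set" and lam :: "'b rel"
  assumes po: "partial_order_on S le" and nomax: "\<not> has_maximum_on S le"
    and ne: "S \<noteq> {}" and lam: "Cinfinite lam"
  shows "lam \<le>o card_Sup {dom_num S le \<kappa> | \<kappa> :: 'b rel. Cnotzero \<kappa> \<and> \<kappa> <o lam}"
    (is "_ \<le>o card_Sup ?R")
proof -
  define s where "s = card_Sup ?R"
  have R: "\<forall>r\<in>?R. Card_order r" using Card_order_dom_num[OF po] by blast
  have s: "Card_order s" using card_Sup_spec[OF R] unfolding s_def by blast
  have upper: "r \<le>o s" if "r \<in> ?R" for r
    using card_Sup_upper[OF R that] unfolding s_def .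
  have "lam \<le>o s"
  proof (rule ccontr)
    assume "\<not> lam \<le>o s"
    then have less: "s <o lam"
      using ordLess_or_ordLeq[OF card_order_on_well_order_on[OF s]
          card_order_on_well_order_on[OF conjunct2[OF lam]]] by blast
    \<comment> \<open>The supremum lives on the type of functions, while exponents live on
      \<open>'b\<close>; \<open>p\<close> is a copy of it there.\<close>
    obtain p :: "'b rel" where p: "s =o p" "p <o lam" using iffD1[OF internalize_ordLess less] by blast
    have card_p: "Card_order p" using Card_order_ordIso2[OF s p(1)] .
    obtain a where a: "a \<in> Field lam" using Cnotzero_imp_not_empty[OF Cinfinite_Cnotzero[OF lam]] by blast
    \<comment> \<open>Zero is not an admissible exponent, so in that case a non-empty segment
      replaces \<open>p\<close>. Only \<open>p \<le>o \<kappa>\<close> is used afterwards.\<close>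
    define \<kappa> where "\<kappa> = (if p =o (czero :: 'b rel) then |under lam a| else p)"
    have \<kappa>: "Cnotzero \<kappa>" "\<kappa> <o lam"
      using Cnotzero_under[OF lam a] card_of_under_less[OF lam a] p(2) card_p
      by (auto simp: \<kappa>_def)
    have "p \<le>o \<kappa>"
    proof (cases "p =o (czero :: 'b rel)")
      case True
      then show ?thesis
        using \<kappa>(1) ordIso_ordLeq_trans[OF True] card_of_empty1
        by (auto simp: czero_def card_order_on_well_order_on)
    next
      case False
      then show ?thesis using card_p ordLeq_refl by (simp add: \<kappa>_def)
    qed
    moreover have "dom_num S le \<kappa> \<le>o p"
      using ordLeq_ordIso_trans[OF upper p(1)] \<kappa> by blast
    ultimately have "dom_num S le \<kappa> \<le>o \<kappa>" using ordLeq_transitive by blast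
    then show False
      using less_dom_num[OF po nomax ne] \<kappa>(1) not_ordLess_ordLeq by blast
  qed
  then show ?thesis unfolding s_def .
qed

theorem theorem2p6:
  fixes S :: "'a set" and le :: "'a rel" and lam :: "'b rel"
  assumes "partial_order_on S le"
    and "directed_on S le"
    and "\<not> has_maximum_on S le"
    and "Cinfinite lam"
  shows "dom_num S le lam =o
    ev_dom_num S le lam *c
    card_Sup {dom_num S le \<kappa> | \<kappa> :: 'b rel. Cnotzero \<kappa> \<and> \<kappa> <o lam}"
proof -
  let ?R = "{dom_num S le \<kappa> | \<kappa> :: 'b rel. Cnotzero \<kappa> \<and> \<kappa> <o lam}"
  define s where "s = card_Sup ?R"
  note po = assms(1) and lam = assms(4)
  have R: "\<forall>r\<in>?R. Card_order r" using Card_order_dom_num[OF po] by blast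
  have s: "Card_order s" using card_Sup_spec[OF R] unfolding s_def by blast
  have upper: "r \<le>o s" if "r \<in> ?R" for r
    using card_Sup_upper[OF R that] unfolding s_def .
  have lamF: "Field lam \<noteq> {}" using Cnotzero_imp_not_empty[OF Cinfinite_Cnotzero[OF lam]] .
  obtain D where D: "eventually_dominating S le lam D" "ev_dom_num S le lam = |D|"
    using ev_dom_num_spec[OF po lamF] by blast
  obtain C where C: "dominating S le lam C" "dom_num S le lam = |C|"
    using dom_num_spec[OF po, of lam] by blast
  have "dom_num S le lam =o ev_dom_num S le lam *c s"
  proof (cases "S = {}")
    \<comment> \<open>The empty order is directed and has no maximum, so it has to be treated; as
      \<open>Field lam\<close> is non-empty, there are no functions into it and both sides are
      zero.\<close>
    case True
    have "Func (Field lam) S = {}" using lamF True by (simp add: Func_is_emp)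
    then have "D = {}" "C = {}"
      using C(1) D(1) unfolding dominating_def eventually_dominating_def by blast+
    then show ?thesis using C(2) D(2) by (simp add: cprod_def Field_card_of card_of_empty_ordIso)
  next
    case False
    have lam_s: "lam \<le>o s" using le_card_Sup_dom_num[OF po assms(3) False lam, folded s_def] .
    have s_inf: "Cinfinite s" using cinfinite_mono[OF lam_s] lam s by blast
    have k: "Cnotzero |under lam \<alpha>|" "|under lam \<alpha>| <o lam" if "\<alpha> \<in> Field lam" for \<alpha>
      using Cnotzero_under[OF lam that] card_of_under_less[OF lam that] .
    obtain E where E: "\<And>\<alpha>. dominating S le ( |under lam \<alpha>| ) (E \<alpha>)"
      "\<And>\<alpha>. dom_num S le |under lam \<alpha>| = |E \<alpha>|"
      using dom_num_spec[OF po, of "|under lam _|"] by metis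
    have E_le: "|E \<alpha>| \<le>o s" if "\<alpha> \<in> Field lam" for \<alpha>
      unfolding E(2)[symmetric] using upper k[OF that] by blast
    let ?T = "SIGMA \<alpha>:Field lam. E \<alpha>"
    have "|Field lam| \<le>o s"
      using ordIso_ordLeq_trans[OF card_of_Field_ordIso lam_s] lam by blast
    \<comment> \<open>A sum of at most \<open>s\<close> sets, each of size at most \<open>s\<close>,
      has size at most \<open>s\<close> because \<open>s\<close> is infinite. This absorbs the
      choice of the segment.\<close>
    then have T: "|?T| \<le>o s"
      using card_of_Sigma_ordLeq_infinite_Field[of s "Field lam" E] s_inf E_le
      by (simp add: cinfinite_def)
    have wo: "Well_order lam" using card_order_on_well_order_on[OF conjunct2[OF lam]] .
    have "dom_num S le lam \<le>o |D \<times> ?T|"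
      using dominating_splice[OF wo D(1) E(1)] dom_num_spec[OF po, of lam]
        ordLeq_transitive[OF _ card_of_image] by blast
    moreover have "|D \<times> ?T| \<le>o ev_dom_num S le lam *c s"
      using cprod_mono2[OF T, of "|D|"] D(2) by (simp add: cprod_def Field_card_of)
    ultimately have "dom_num S le lam \<le>o ev_dom_num S le lam *c s"
      by (rule ordLeq_transitive)
    moreover have "ev_dom_num S le lam *c s \<le>o dom_num S le lam"
    proof (rule cprod_cinfinite_bound)
      show "ev_dom_num S le lam \<le>o dom_num S le lam"
        using ev_dom_num_le_dom_num[OF po lamF] .
      \<comment> \<open>By monotonicity \<open>dom_num S le lam\<close> is an upper bound of the
        family. It thereby inherits infinity from \<open>s\<close>, which lets it bound the product
        of the two factors.\<close>
      show s_le: "s \<le>o dom_num S le lam"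
        using card_Sup_least[OF R Card_order_dom_num[OF po], folded s_def] dom_num_mono[OF po False]
          ordLess_imp_ordLeq by blast
      show "Card_order (ev_dom_num S le lam)" using D(2) card_of_Card_order by simp
      show "Card_order s" by (rule s)
      show "Cinfinite (dom_num S le lam)"
        using cinfinite_mono[OF s_le] s_inf Card_order_dom_num[OF po] by blast
    qed
    ultimately show ?thesis by (simp add: ordIso_iff_ordLeq)
  qed
  then show ?thesis unfolding s_def .
qed

end
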